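(* Let $\mathcal R=(R,\oplus,\le,0)$ be a distance magma and $S\subseteq R$ with $0\in S$. Then $\mathcal S^*=(S^*,\oplus^*,\le^*,0)$ is a difference-complete distance magma; that is, it is a distance magma and for all $\alpha,\beta\in S^*$ the set $\{x\in S^*:\alpha\le^*\beta\oplus^* x\text{ and }\beta\le^*\alpha\oplus^* x\}$ has a minimum.
   Context: A distance magma is a structure $(R,\oplus,\le,0)$ with $\oplus$ binary, $0\in R$, such that $\le$ is a total order, $r\le r\oplus s$, $r\le t,s\le u\Rightarrow r\oplus s\le t\oplus u$, $\oplus$ commutative, $0$ an identity. A distance magma is difference-complete if for all $r,s$ the set $\{x: r\le s\oplus x\text{ and } s\le r\oplus x\}$ has a minimal element. $\mathcal S^*$: $\mathcal L_S$ has binary relation symbols $d(x,y)\le s$ ($s\in S$). $T_{\mathrm{MS}}(S,\mathcal R)$ is: $\forall x\forall y(d(x,y)\le0\leftrightarrow x=y)$; $\forall x\forall y(d(x,y)\le s\leftrightarrow d(y,x)\le s)$ for $s\in S$; for $r,s,t\in S$ with no $x\in S$ satisfying $t<x\le r\oplus s$, $\forall x\forall y\forall z((d(x,y)\le r\wedge d(y,z)\le s)\to d(x,z)\le t)$; if $S$ has a maximum $s$, $\forall x\forall y\,d(x,y)\le s$. A cut in $S$ is an upward-closed $X\subseteq S$ containing $\max S$ if it exists; $S^*$ is the set of cuts ordered by $X\le^*Y\iff Y\subseteq X$ (a complete linear order), with $r\in S$ identified with $\{x\in S:x\ge r\}$. For $\alpha\in S^*$, $p_\alpha(x,y)=\{d(x,y)\le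 s:\alpha\le^* s\}\cup\{\neg d(x,y)\le s:s<^*\alpha\}$ ($s\in S$). $\alpha\oplus^*\beta$ is the supremum of the set of $\gamma\in S^*$ for which $T_{\mathrm{MS}}(S,\mathcal R)\cup p_\alpha(x,y)\cup p_\beta(y,z)\cup p_\gamma(x,z)$ is consistent. *)

theory Defs
  imports Main
begin

section \<open>Distance magmas\<close>

text \<open>The carrier is explicit because the cuts below form only a part of a type. Associativity
  is not required.\<close>

locale distance_magma =
  fixes R :: "'a set" and add :: "'a \<Rightarrow> 'a \<Rightarrow> 'a" and le :: "'a \<Rightarrow> 'a \<Rightarrow> bool" and zero :: 'a
  assumes zero_closed: "zero \<in> R"
    and add_closed: "r \<in> R \<Longrightarrow> s \<in> R \<Longrightarrow> add r s \<in> R"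
    and le_refl: "reflp_on R le"
    and le_antisym: "antisymp_on R le"
    and le_trans: "transp_on R le"
    and le_total: "totalp_on R le"
    and le_add: "r \<in> R \<Longrightarrow> s \<in> R \<Longrightarrow> le r (add r s)"
    and add_mono: "r \<in> R \<Longrightarrow> s \<in> R \<Longrightarrow> t \<in> R \<Longrightarrow> u \<in> R \<Longrightarrow> le r t \<Longrightarrow> le s u \<Longrightarrow>
                     le (add r s) (add t u)"
    and add_commute: "r \<in> R \<Longrightarrow> s \<in> R \<Longrightarrow> add r s = add s r"
    and add_zero: "r \<in> R \<Longrightarrow> add r zero = r"

definition is_minimum :: "('a \<Rightarrow> 'a \<Rightarrow> bool) \<Rightarrow> 'a set \<Rightarrow> 'a \<Rightarrow> bool" where
  "is_minimum le X m \<longleftrightarrow> m \<in> X \<and> (\<forall>x\<in>X. le m x)"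

definition is_maximum :: "('a \<Rightarrow> 'a \<Rightarrow> bool) \<Rightarrow> 'a set \<Rightarrow> 'a \<Rightarrow> bool" where
  "is_maximum le X m \<longleftrightarrow> m \<in> X \<and> (\<forall>x\<in>X. le x m)"

text \<open>The order being total, a minimal element is the same as a minimum.\<close>

locale difference_complete_distance_magma = distance_magma +
  assumes difference_complete: "r \<in> R \<Longrightarrow> s \<in> R \<Longrightarrow>
    \<exists>m. is_minimum le {x \<in> R. le r (add s x) \<and> le s (add r x)} m"


section \<open>First-order logic with binary relation symbols \<open>d(x,y) \<le> s\<close>\<close>

text \<open>The language has no function symbols, so every term is a variable. Variables are de Bruijn
  indices: \<open>All\<close> binds index \<open>0\<close> of its body and shifts the remaining ones, and indices exceeding
  the binders around them are free variables. \<open>DLe s i j\<close> is the atomic formula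
  \<open>d(v\<^sub>i,v\<^sub>j) \<le> s\<close>.\<close>

datatype 's fm =
    Fls
  | Eq nat nat
  | DLe 's nat nat
  | Imp "'s fm" "'s fm"
  | All "'s fm"

abbreviation Neg :: "'s fm \<Rightarrow> 's fm" where
  "Neg \<phi> \<equiv> Imp \<phi> Fls"

abbreviation Conj :: "'s fm \<Rightarrow> 's fm \<Rightarrow> 's fm" where
  "Conj \<phi> \<psi> \<equiv> Neg (Imp \<phi> (Neg \<psi>))"

abbreviation Iff :: "'s fm \<Rightarrow> 's fm \<Rightarrow> 's fm" where
  "Iff \<phi> \<psi> \<equiv> Conj (Imp \<phi> \<psi>) (Imp \<psi> \<phi>)"

primrec rename :: "(nat \<Rightarrow> nat) \<Rightarrow> 's fm \<Rightarrow> 's fm" where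
  "rename f Fls = Fls"
| "rename f (Eq i j) = Eq (f i) (f j)"
| "rename f (DLe s i j) = DLe s (f i) (f j)"
| "rename f (Imp \<phi> \<psi>) = Imp (rename f \<phi>) (rename f \<psi>)"
| "rename f (All \<phi>) = All (rename (case_nat 0 (\<lambda>n. Suc (f n))) \<phi>)"

text \<open>\<open>inst i \<phi>\<close> substitutes the variable \<open>i\<close> for index \<open>0\<close>, lowering the other indices.\<close>

definition inst :: "nat \<Rightarrow> 's fm \<Rightarrow> 's fm" where
  "inst i = rename (case_nat i (\<lambda>n. n))"

text \<open>Classical natural deduction with equality. In \<open>AllI\<close>, shifting the hypotheses makes
  index \<open>0\<close> fresh, which is the usual eigenvariable condition.\<close>

inductive derives :: "'s fm set \<Rightarrow> 's fm \<Rightarrow> bool" (infix "\<turnstile>" 50) where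
  Assm: "\<phi> \<in> \<Gamma> \<Longrightarrow> \<Gamma> \<turnstile> \<phi>"
| Contr: "insert (Neg \<phi>) \<Gamma> \<turnstile> Fls \<Longrightarrow> \<Gamma> \<turnstile> \<phi>"
| ImpI: "insert \<phi> \<Gamma> \<turnstile> \<psi> \<Longrightarrow> \<Gamma> \<turnstile> Imp \<phi> \<psi>"
| ImpE: "\<Gamma> \<turnstile> Imp \<phi> \<psi> \<Longrightarrow> \<Gamma> \<turnstile> \<phi> \<Longrightarrow> \<Gamma> \<turnstile> \<psi>"
| AllI: "rename Suc ` \<Gamma> \<turnstile> \<phi> \<Longrightarrow> \<Gamma> \<turnstile> All \<phi>"
| AllE: "\<Gamma> \<turnstile> All \<phi> \<Longrightarrow> \<Gamma> \<turnstile> inst i \<phi>"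
| EqRefl: "\<Gamma> \<turnstile> Eq i i"
| EqSubst: "\<Gamma> \<turnstile> Eq i j \<Longrightarrow> \<Gamma> \<turnstile> inst i \<phi> \<Longrightarrow> \<Gamma> \<turnstile> inst j \<phi>"

text \<open>Syntactic consistency avoids having to fix a type in which the models live; by the
  completeness theorem it amounts to satisfiability in some structure. Formulas may mention
  symbols \<open>d(x,y) \<le> s\<close> for every \<open>s\<close> of the type; derivations using symbols that do not
  occur in \<open>\<Gamma>\<close> do not affect its consistency.\<close>

definition consistent :: "'s fm set \<Rightarrow> bool" where
  "consistent \<Gamma> \<longleftrightarrow> \<not> \<Gamma> \<turnstile> Fls"


section \<open>The theory of \<open>S\<close>-metric spaces\<close>

definition strict :: "('a \<Rightarrow> 'a \<Rightarrow> bool) \<Rightarrow> 'a \<Rightarrow> 'a \<Rightarrow> bool" where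
  "strict le x y \<longleftrightarrow> le x y \<and> x \<noteq> y"

text \<open>With two quantifiers \<open>x\<close> and \<open>y\<close> are the indices \<open>1\<close> and \<open>0\<close>; with three quantifiers
  \<open>x\<close>, \<open>y\<close>, \<open>z\<close> are \<open>2\<close>, \<open>1\<close>, \<open>0\<close>.\<close>

definition T_MS ::
  "('a \<Rightarrow> 'a \<Rightarrow> 'a) \<Rightarrow> ('a \<Rightarrow> 'a \<Rightarrow> bool) \<Rightarrow> 'a \<Rightarrow> 'a set \<Rightarrow> 'a fm set" where
  "T_MS add le zero S =
     {All (All (Iff (DLe zero 1 0) (Eq 1 0)))}
   \<union> {All (All (Iff (DLe s 1 0) (DLe s 0 1))) | s. s \<in> S}
   \<union> {All (All (All (Imp (Conj (DLe r 2 1) (DLe s 1 0)) (DLe t 2 0)))) | r s t.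
        r \<in> S \<and> s \<in> S \<and> t \<in> S \<and> \<not> (\<exists>x\<in>S. strict le t x \<and> le x (add r s))}
   \<union> {All (All (DLe s 1 0)) | s. is_maximum le S s}"


section \<open>The structure of cuts\<close>

definition cuts :: "('a \<Rightarrow> 'a \<Rightarrow> bool) \<Rightarrow> 'a set \<Rightarrow> 'a set set" where
  "cuts le S = {X. X \<subseteq> S \<and> (\<forall>x\<in>X. \<forall>y\<in>S. le x y \<longrightarrow> y \<in> X) \<and> (\<forall>m. is_maximum le S m \<longrightarrow> m \<in> X)}"

definition cut_le :: "'a set \<Rightarrow> 'a set \<Rightarrow> bool" where
  "cut_le X Y \<longleftrightarrow> Y \<subseteq> X"

definition cut_of :: "('a \<Rightarrow> 'a \<Rightarrow> bool) \<Rightarrow> 'a set \<Rightarrow> 'a \<Rightarrow> 'a set" where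
  "cut_of le S r = {x \<in> S. le r x}"

definition cut_type ::
  "('a \<Rightarrow> 'a \<Rightarrow> bool) \<Rightarrow> 'a set \<Rightarrow> 'a set \<Rightarrow> nat \<Rightarrow> nat \<Rightarrow> 'a fm set" where
  "cut_type le S \<alpha> i j =
     {DLe s i j | s. s \<in> S \<and> cut_le \<alpha> (cut_of le S s)}
   \<union> {Neg (DLe s i j) | s. s \<in> S \<and> strict cut_le (cut_of le S s) \<alpha>}"

definition is_supremum :: "'b set \<Rightarrow> ('b \<Rightarrow> 'b \<Rightarrow> bool) \<Rightarrow> 'b set \<Rightarrow> 'b \<Rightarrow> bool" where
  "is_supremum A le X u \<longleftrightarrow> is_minimum le {v \<in> A. \<forall>x\<in>X. le x v} u"

text \<open>The free variables \<open>x\<close>, \<open>y\<close>, \<open>z\<close> are the indices \<open>0\<close>, \<open>1\<close>, \<open>2\<close>.\<close>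

definition cut_add ::
  "('a \<Rightarrow> 'a \<Rightarrow> 'a) \<Rightarrow> ('a \<Rightarrow> 'a \<Rightarrow> bool) \<Rightarrow> 'a \<Rightarrow> 'a set \<Rightarrow> 'a set \<Rightarrow> 'a set \<Rightarrow> 'a set" where
  "cut_add add le zero S \<alpha> \<beta> =
     (THE \<sigma>. is_supremum (cuts le S) cut_le
        {\<gamma> \<in> cuts le S. consistent (T_MS add le zero S
            \<union> cut_type le S \<alpha> 0 1 \<union> cut_type le S \<beta> 1 2 \<union> cut_type le S \<gamma> 0 2)} \<sigma>)"

end

(* For cuts A, B let A + B be the set of all t in S such that some r in A and s in B have no
   element of S in the half-open interval from t (excluded) to r + s (included). The triangle
   axioms force A + B to be contained in every C that is consistent with A and B as the third
   side of a triangle, and the three-point structure with sides A, B, A + B is a model of the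
   theory. Since the order on cuts is reversed inclusion, A + B is the supremum defining the sum
   of cuts. This description is monotone in A and B and commutes with nonempty unions, so the
   union of all X with B + X <= A and A + X <= B as sets is the required minimum; the family
   contains the intersection of A and B. *)

theory Submission
  imports Defs
begin

section \<open>Soundness\<close>

text \<open>Equality is interpreted by an arbitrary congruence \<open>E\<close>, so that points at distance
  \<open>0\<close> need not be identified when building a model.\<close>

primrec sat ::
  "('s \<Rightarrow> 'u \<Rightarrow> 'u \<Rightarrow> bool) \<Rightarrow> ('u \<Rightarrow> 'u \<Rightarrow> bool) \<Rightarrow> (nat \<Rightarrow> 'u) \<Rightarrow> 's fm \<Rightarrow> bool" where
  "sat D E e Fls = False"
| "sat D E e (Eq i j) = E (e i) (e j)"
| "sat D E e (DLe s i j) = D s (e i) (e j)"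
| "sat D E e (Imp \<phi> \<psi>) = (sat D E e \<phi> \<longrightarrow> sat D E e \<psi>)"
| "sat D E e (All \<phi>) = (\<forall>a. sat D E (case_nat a e) \<phi>)"

lemma sat_rename: "sat D E e (rename f \<phi>) \<longleftrightarrow> sat D E (\<lambda>n. e (f n)) \<phi>"
proof (induction \<phi> arbitrary: e f)
  case (All \<phi>)
  have "(\<lambda>n. case_nat a e (case_nat 0 (\<lambda>n. Suc (f n)) n)) = case_nat a (\<lambda>n. e (f n))" for a
    by (auto simp: fun_eq_iff split: nat.split)
  with All show ?case by simp
qed auto

lemma sat_inst: "sat D E e (inst i \<phi>) \<longleftrightarrow> sat D E (case_nat (e i) e) \<phi>"
proof -
  have "(\<lambda>n. e (case_nat i (\<lambda>n. n) n)) = case_nat (e i) e"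
    by (auto simp: fun_eq_iff split: nat.split)
  then show ?thesis by (simp add: inst_def sat_rename)
qed

locale congruence_structure =
  fixes D :: "'s \<Rightarrow> 'u \<Rightarrow> 'u \<Rightarrow> bool" and E :: "'u \<Rightarrow> 'u \<Rightarrow> bool"
  assumes E_refl: "E a a"
    and E_sym: "E a b \<Longrightarrow> E b a"
    and E_trans: "E a b \<Longrightarrow> E b c \<Longrightarrow> E a c"
    and D_cong: "E a a' \<Longrightarrow> E b b' \<Longrightarrow> D s a b \<Longrightarrow> D s a' b'"
begin

text \<open>Needed for the rule \<open>EqSubst\<close>: variables declared equal denote points that
  are merely \<open>E\<close>-related, so truth has to be invariant under \<open>E\<close>.\<close>

lemma sat_cong:
  assumes "\<And>n. E (e n) (e' n)"
  shows "sat D E e \<phi> \<longleftrightarrow> sat D E e' \<phi>"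
  using assms
proof (induction \<phi> arbitrary: e e')
  case (All \<phi>)
  have "E (case_nat a e n) (case_nat a e' n)" for a n
    using All.prems E_refl by (simp split: nat.split)
  from All.IH[OF this] show ?case by simp
next
  case (Eq i j)
  from this[of i] this[of j] show ?case
    unfolding sat.simps by (blast intro: E_sym E_trans)
next
  case (DLe s i j)
  from this[of i] this[of j] show ?case
    unfolding sat.simps using D_cong E_sym by blast
next
  case (Imp \<phi> \<psi>)
  from Imp.IH[OF Imp.prems] show ?case by simp
qed simp

lemma soundness:
  assumes "\<Gamma> \<turnstile> \<phi>" and "\<And>\<psi>. \<psi> \<in> \<Gamma> \<Longrightarrow> sat D E e \<psi>"
  shows "sat D E e \<phi>"
  using assms
proof (induction arbitrary: e rule: derives.induct)
  case (Assm \<phi> \<Gamma>)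
  then show ?case by blast
next
  case (Contr \<phi> \<Gamma>)
  have False if "\<not> sat D E e \<phi>"
  proof -
    have "sat D E e \<psi>" if "\<psi> \<in> insert (Neg \<phi>) \<Gamma>" for \<psi>
      using that \<open>\<not> sat D E e \<phi>\<close> Contr.prems by auto
    from Contr.IH[OF this] show False by simp
  qed
  then show ?case by blast
next
  case (ImpI \<phi> \<Gamma> \<psi>)
  have "sat D E e \<psi>" if "sat D E e \<phi>"
    by (rule ImpI.IH) (use that ImpI.prems in blast)
  then show ?case by simp
next
  case (ImpE \<Gamma> \<phi> \<psi>)
  from ImpE.IH[OF ImpE.prems] show ?case by simp
next
  case (AllI \<Gamma> \<phi>)
  \<comment> \<open>Shifted hypotheses do not mention index 0, so they stay true whatever point
    \<open>a\<close> is put there.\<close>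
  have "sat D E (case_nat a e) \<phi>" for a
    by (rule AllI.IH) (auto simp: sat_rename AllI.prems)
  then show ?case by simp
next
  case (AllE \<Gamma> \<phi> i)
  from AllE.IH[OF AllE.prems] show ?case by (simp add: sat_inst)
next
  case (EqRefl \<Gamma> i)
  show ?case by (simp add: E_refl)
next
  case (EqSubst \<Gamma> i j \<phi>)
  have "E (e i) (e j)"
    using EqSubst.IH(1)[OF EqSubst.prems] by simp
  then have "E (case_nat (e i) e n) (case_nat (e j) e n)" for n
    using E_refl by (simp split: nat.split)
  from sat_cong[OF this] EqSubst.IH(2)[OF EqSubst.prems] show ?case by (simp add: sat_inst)
qed

lemma consistent_of_model:
  assumes "\<And>\<psi>. \<psi> \<in> \<Gamma> \<Longrightarrow> sat D E e \<psi>"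
  shows "consistent \<Gamma>"
  using soundness[of \<Gamma> Fls e] assms by (auto simp: consistent_def)

end

lemma derives_Conj:
  assumes "\<phi> \<in> \<Gamma>" and "\<psi> \<in> \<Gamma>"
  shows "\<Gamma> \<turnstile> Conj \<phi> \<psi>"
proof (rule ImpI)
  let ?\<Delta> = "insert (Imp \<phi> (Neg \<psi>)) \<Gamma>"
  have "?\<Delta> \<turnstile> Neg \<psi>"
    by (rule ImpE[of _ \<phi>]) (auto intro: Assm assms)
  then show "?\<Delta> \<turnstile> Fls"
    by (rule ImpE) (auto intro: Assm assms)
qed


section \<open>Sums of cuts\<close>

datatype point = PX | PY | PZ

text \<open>Distance function of a three-point space. It is used with cuts as values and with
  \<delta> = \<open>S\<close>, which is the zero of the structure of cuts.\<close>

fun side :: "'b \<Rightarrow> 'b \<Rightarrow> 'b \<Rightarrow> 'b \<Rightarrow> point \<Rightarrow> point \<Rightarrow> 'b" where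
  "side \<delta> \<alpha> \<beta> \<gamma> PX PY = \<alpha>"
| "side \<delta> \<alpha> \<beta> \<gamma> PY PX = \<alpha>"
| "side \<delta> \<alpha> \<beta> \<gamma> PY PZ = \<beta>"
| "side \<delta> \<alpha> \<beta> \<gamma> PZ PY = \<beta>"
| "side \<delta> \<alpha> \<beta> \<gamma> PX PZ = \<gamma>"
| "side \<delta> \<alpha> \<beta> \<gamma> PZ PX = \<gamma>"
| "side \<delta> \<alpha> \<beta> \<gamma> PX PX = \<delta>"
| "side \<delta> \<alpha> \<beta> \<gamma> PY PY = \<delta>"
| "side \<delta> \<alpha> \<beta> \<gamma> PZ PZ = \<delta>"

lemma side_commute: "side \<delta> \<alpha> \<beta> \<gamma> a b = side \<delta> \<alpha> \<beta> \<gamma> b a"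
  by (cases a; cases b) auto

lemma side_same [simp]: "side \<delta> \<alpha> \<beta> \<gamma> a a = \<delta>"
  by (cases a) auto

locale distance_magma_subset = distance_magma R add le zero
  for R :: "'a set" and add le zero +
  fixes S :: "'a set"
  assumes S_subset: "S \<subseteq> R" and zero_in_S: "zero \<in> S"
begin

section \<open>The order of the magma and gaps in \<open>S\<close>\<close>

lemma S_R: "s \<in> S \<Longrightarrow> s \<in> R"
  using S_subset by blast

lemma le_reflD: "r \<in> R \<Longrightarrow> le r r"
  by (rule reflp_onD[OF le_refl])

lemma le_transD: "le r s \<Longrightarrow> le s t \<Longrightarrow> r \<in> R \<Longrightarrow> s \<in> R \<Longrightarrow> t \<in> R \<Longrightarrow> le r t"
  by (rule transp_onD[OF le_trans])

lemma le_antisymD: "le r s \<Longrightarrow> le s r \<Longrightarrow> r \<in> R \<Longrightarrow> s \<in> R \<Longrightarrow> r = s"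
  by (rule antisymp_onD[OF le_antisym])

lemma le_linear: "r \<in> R \<Longrightarrow> s \<in> R \<Longrightarrow> le r s \<or> le s r"
  using totalp_onD[OF le_total, of r s] le_reflD by blast

lemma not_le_strict: "r \<in> R \<Longrightarrow> s \<in> R \<Longrightarrow> \<not> le r s \<Longrightarrow> strict le s r"
  using le_linear[of r s] le_reflD[of r] unfolding strict_def by blast

lemma zero_le: "r \<in> R \<Longrightarrow> le zero r"
  using le_add[of zero r] add_commute[of zero r] add_zero[of r] zero_closed by simp

text \<open>The side condition under which \<open>T_MS\<close> has a triangle axiom for r, s, t:
  seen from \<open>S\<close>, t already bounds r + s.\<close>

definition gap :: "'a \<Rightarrow> 'a \<Rightarrow> 'a \<Rightarrow> bool" where
  "gap r s t \<longleftrightarrow> \<not> (\<exists>x\<in>S. strict le t x \<and> le x (add r s))"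

lemma gap_commute: "r \<in> S \<Longrightarrow> s \<in> S \<Longrightarrow> gap r s t \<Longrightarrow> gap s r t"
  by (simp add: gap_def add_commute S_R)

text \<open>Otherwise r itself would be an element of \<open>S\<close> strictly above t and at most
  r + s.\<close>

lemma gap_le1: "r \<in> S \<Longrightarrow> s \<in> S \<Longrightarrow> t \<in> S \<Longrightarrow> gap r s t \<Longrightarrow> le r t"
  using not_le_strict[of r t] le_add[of r s] S_R unfolding gap_def by blast

lemma gap_le2: "r \<in> S \<Longrightarrow> s \<in> S \<Longrightarrow> t \<in> S \<Longrightarrow> gap r s t \<Longrightarrow> le s t"
  using gap_le1 gap_commute by blast

lemma gap_zero: "t \<in> S \<Longrightarrow> gap t zero t"
  unfolding gap_def strict_def using le_antisymD[of t] S_R add_zero[of t] by auto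

lemma gap_mono:
  assumes "gap r s t" "le t u" "r \<in> S" "s \<in> S" "t \<in> S" "u \<in> S"
  shows "gap r s u"
  unfolding gap_def
proof
  assume "\<exists>x\<in>S. strict le u x \<and> le x (add r s)"
  then obtain x where x: "x \<in> S" "strict le u x" "le x (add r s)" by blast
  then have "strict le t x"
    using assms le_transD[of t u x] le_antisymD[of u x] S_R by (auto simp: strict_def)
  with x assms(1) show False by (auto simp: gap_def)
qed

lemma gap_maximum: "is_maximum le S m \<Longrightarrow> gap r s m"
  unfolding gap_def is_maximum_def strict_def using le_antisymD S_R by blast

section \<open>Cuts, their linear order and their types\<close>

lemma cutsD: "\<alpha> \<in> cuts le S \<Longrightarrow> s \<in> \<alpha> \<Longrightarrow> t \<in> S \<Longrightarrow> le s t \<Longrightarrow> t \<in> \<alpha>"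
  by (auto simp: cuts_def)

lemma cuts_subset: "\<alpha> \<in> cuts le S \<Longrightarrow> \<alpha> \<subseteq> S"
  by (auto simp: cuts_def)

lemma cuts_maximum: "\<alpha> \<in> cuts le S \<Longrightarrow> is_maximum le S m \<Longrightarrow> m \<in> \<alpha>"
  by (auto simp: cuts_def)

text \<open>Elements witnessing that neither cut contains the other would be comparable in
  \<open>R\<close>, and upward closure then contradicts the choice of one of them.\<close>

lemma cuts_linear:
  assumes "\<alpha> \<in> cuts le S" "\<beta> \<in> cuts le S"
  shows "\<alpha> \<subseteq> \<beta> \<or> \<beta> \<subseteq> \<alpha>"
proof (rule ccontr)
  assume "\<not> ?thesis"
  then obtain a b where "a \<in> \<alpha>" "a \<notin> \<beta>" "b \<in> \<beta>" "b \<notin> \<alpha>" by blast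
  then show False
    using le_linear[of a b] cutsD[OF assms(1), of a b] cutsD[OF assms(2), of b a]
      assms[THEN cuts_subset] S_R by blast
qed

lemma cut_of_zero: "cut_of le S zero = S"
  using zero_le S_R by (auto simp: cut_of_def)

lemma S_in_cuts: "S \<in> cuts le S"
  by (auto simp: cuts_def is_maximum_def)

text \<open>\<alpha> lies below the cut of s exactly when s \<in> \<alpha>, and strictly above it
  otherwise, so the type merely records membership in \<alpha>.\<close>

lemma cut_type_eq:
  assumes "\<alpha> \<in> cuts le S"
  shows "cut_type le S \<alpha> i j = {DLe s i j | s. s \<in> \<alpha>} \<union> {Neg (DLe s i j) | s. s \<in> S - \<alpha>}"
proof -
  have le: "cut_le \<alpha> (cut_of le S s) \<longleftrightarrow> s \<in> \<alpha>" if "s \<in> S" for s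
    using that cutsD[OF assms] le_reflD S_R by (auto simp: cut_le_def cut_of_def)
  have "strict cut_le (cut_of le S s) \<alpha> \<longleftrightarrow> s \<notin> \<alpha>" if s: "s \<in> S" for s
  proof
    assume "strict cut_le (cut_of le S s) \<alpha>"
    then show "s \<notin> \<alpha>" using le[OF s] by (auto simp: strict_def cut_le_def)
  next
    assume n: "s \<notin> \<alpha>"
    \<comment> \<open>If t were below s, upward closure would put s into \<alpha>.\<close>
    have "le s t" if "t \<in> \<alpha>" for t
      using that n s le_linear[of s t] cutsD[OF assms] cuts_subset[OF assms] S_R by blast
    then show "strict cut_le (cut_of le S s) \<alpha>"
      using n le[OF s] cuts_subset[OF assms] by (auto simp: strict_def cut_le_def cut_of_def)
  qed
  then show ?thesis
    using le cuts_subset[OF assms] by (auto simp: cut_type_def)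
qed

section \<open>The explicit sum of cuts\<close>

definition cut_sum :: "'a set \<Rightarrow> 'a set \<Rightarrow> 'a set" where
  "cut_sum \<alpha> \<beta> = {t \<in> S. \<exists>r\<in>\<alpha>. \<exists>s\<in>\<beta>. gap r s t}"

lemma cut_sum_in_cuts:
  assumes "\<alpha> \<in> cuts le S" "\<beta> \<in> cuts le S"
  shows "cut_sum \<alpha> \<beta> \<in> cuts le S"
proof -
  have "u \<in> cut_sum \<alpha> \<beta>" if "t \<in> cut_sum \<alpha> \<beta>" "u \<in> S" "le t u" for t u
    using that gap_mono assms[THEN cuts_subset] unfolding cut_sum_def by blast
  moreover have "m \<in> cut_sum \<alpha> \<beta>" if "is_maximum le S m" for m
    using gap_maximum[OF that] assms[THEN cuts_maximum, OF that] that
    unfolding cut_sum_def is_maximum_def by blast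
  ultimately show ?thesis by (auto simp: cuts_def cut_sum_def)
qed

lemma cut_sum_mono: "\<alpha> \<subseteq> \<alpha>' \<Longrightarrow> \<beta> \<subseteq> \<beta>' \<Longrightarrow> cut_sum \<alpha> \<beta> \<subseteq> cut_sum \<alpha>' \<beta>'"
  unfolding cut_sum_def by blast

lemma cut_sum_commute:
  assumes "\<alpha> \<in> cuts le S" "\<beta> \<in> cuts le S"
  shows "cut_sum \<alpha> \<beta> = cut_sum \<beta> \<alpha>"
  using gap_commute assms[THEN cuts_subset] unfolding cut_sum_def by blast

text \<open>For the reversed order this is the axiom r \<le> r + s; it comes from
  \<open>gap_le1\<close> and upward closure.\<close>

lemma cut_sum_subset:
  assumes "\<alpha> \<in> cuts le S" "\<beta> \<in> cuts le S"
  shows "cut_sum \<alpha> \<beta> \<subseteq> \<alpha>"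
  using gap_le1 cutsD[OF assms(1)] assms[THEN cuts_subset] unfolding cut_sum_def by blast

lemma cut_sum_zero:
  assumes "\<alpha> \<in> cuts le S"
  shows "cut_sum \<alpha> S = \<alpha>"
proof
  show "\<alpha> \<subseteq> cut_sum \<alpha> S"
    using gap_zero zero_in_S cuts_subset[OF assms] unfolding cut_sum_def by blast
qed (rule cut_sum_subset[OF assms S_in_cuts])

section \<open>Consistent triangles and the supremum\<close>

lemma cut_sum_least:
  assumes "\<alpha> \<in> cuts le S" "\<beta> \<in> cuts le S" "\<gamma> \<in> cuts le S"
    and cons: "consistent (T_MS add le zero S
      \<union> cut_type le S \<alpha> 0 1 \<union> cut_type le S \<beta> 1 2 \<union> cut_type le S \<gamma> 0 2)"
      (is "consistent ?\<Gamma>")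
  shows "cut_sum \<alpha> \<beta> \<subseteq> \<gamma>"
proof
  fix t
  assume "t \<in> cut_sum \<alpha> \<beta>"
  then obtain r s where rs: "r \<in> \<alpha>" "s \<in> \<beta>" "gap r s t" "t \<in> S"
    by (auto simp: cut_sum_def)
  show "t \<in> \<gamma>"
  proof (rule ccontr)
    assume "t \<notin> \<gamma>"
    let ?\<phi> = "Imp (Conj (DLe r 2 1) (DLe s 1 0)) (DLe t 2 0)"
    have "All (All (All ?\<phi>)) \<in> ?\<Gamma>"
      using rs assms(1,2)[THEN cuts_subset] unfolding T_MS_def gap_def by blast
    then have "?\<Gamma> \<turnstile> All (All (All ?\<phi>))" by (rule Assm)
    \<comment> \<open>The quantifiers are instantiated from the outside by the variables 0, 1, 2.
      Below the two remaining binders the free variable 0 has index 2, so the body at first looks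
      unchanged.\<close>
    from AllE[OF this, of 0]
    have "?\<Gamma> \<turnstile> All (All ?\<phi>)"
      by (simp add: inst_def numeral_2_eq_2)
    from AllE[OF this, of 1]
    have "?\<Gamma> \<turnstile> All (Imp (Conj (DLe r 1 2) (DLe s 2 0)) (DLe t 1 0))"
      by (simp add: inst_def numeral_2_eq_2)
    from AllE[OF this, of 2]
    have "?\<Gamma> \<turnstile> Imp (Conj (DLe r 0 1) (DLe s 1 2)) (DLe t 0 2)"
      by (simp add: inst_def numeral_2_eq_2)
    moreover have "?\<Gamma> \<turnstile> Conj (DLe r 0 1) (DLe s 1 2)"
      using rs by (intro derives_Conj) (auto simp: cut_type_eq assms(1-3))
    ultimately have "?\<Gamma> \<turnstile> DLe t 0 2" by (rule ImpE)
    moreover have "?\<Gamma> \<turnstile> Neg (DLe t 0 2)"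
      using rs \<open>t \<notin> \<gamma>\<close> by (intro Assm) (auto simp: cut_type_eq assms(1-3))
    ultimately show False
      using cons ImpE unfolding consistent_def by blast
  qed
qed

text \<open>As t bounds r and s, it lies in both given sides, which settles all cases with two
  coinciding points. In a proper triangle, if one given side is the sum, it is contained in the
  third side; if the given sides are \<alpha> and \<beta>, the definition of the sum
  applies.\<close>

lemma triangle_cut_sum:
  assumes \<alpha>: "\<alpha> \<in> cuts le S" and \<beta>: "\<beta> \<in> cuts le S"
  defines "d \<equiv> side S \<alpha> \<beta> (cut_sum \<alpha> \<beta>)"
  assumes r: "r \<in> d a b" and s: "s \<in> d b c" and t: "t \<in> S" and g: "gap r s t"
  shows "t \<in> d a c"
proof -
  let ?\<gamma> = "cut_sum \<alpha> \<beta>"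
  have \<gamma>: "?\<gamma> \<in> cuts le S" by (rule cut_sum_in_cuts[OF \<alpha> \<beta>])
  have d_cuts: "d a b \<in> cuts le S" for a b
    unfolding d_def using \<alpha> \<beta> \<gamma> S_in_cuts by (cases a; cases b) simp_all
  have rs: "r \<in> S" "s \<in> S"
    using r s d_cuts cuts_subset by blast+
  have "le r t" "le s t"
    using gap_le1 gap_le2 rs t g by blast+
  then have t_r: "t \<in> d a b" and t_s: "t \<in> d b c"
    using r s t cutsD[OF d_cuts] by blast+
  have "?\<gamma> \<subseteq> \<alpha>" "?\<gamma> \<subseteq> \<beta>"
    using cut_sum_subset[OF \<alpha> \<beta>] cut_sum_subset[OF \<beta> \<alpha>] cut_sum_commute[OF \<alpha> \<beta>] by auto
  moreover have "t \<in> ?\<gamma>" if "r \<in> \<alpha>" "s \<in> \<beta>"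
    using that t g by (auto simp: cut_sum_def)
  moreover have "t \<in> ?\<gamma>" if "r \<in> \<beta>" "s \<in> \<alpha>"
    using that t gap_commute[OF rs g] by (auto simp: cut_sum_def)
  ultimately show ?thesis
    using r s t t_r t_s unfolding d_def by (cases a; cases b; cases c) (simp_all, blast+)
qed

lemma consistent_cut_sum:
  assumes \<alpha>: "\<alpha> \<in> cuts le S" and \<beta>: "\<beta> \<in> cuts le S"
  shows "consistent (T_MS add le zero S
      \<union> cut_type le S \<alpha> 0 1 \<union> cut_type le S \<beta> 1 2 \<union> cut_type le S (cut_sum \<alpha> \<beta>) 0 2)"
proof -
  let ?\<gamma> = "cut_sum \<alpha> \<beta>"
  define d where "d = side S \<alpha> \<beta> ?\<gamma>"
  define D where "D s a b \<longleftrightarrow> s \<in> d a b" for s a b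
  \<comment> \<open>The variables 0, 1, 2 of the three types denote the three points;
    \<open>PZ\<close> is the default from index 2 on.\<close>
  define e where "e = case_nat PX (case_nat PY (\<lambda>_. PZ))"
  have \<gamma>: "?\<gamma> \<in> cuts le S" by (rule cut_sum_in_cuts[OF \<alpha> \<beta>])
  have d_cuts: "d a b \<in> cuts le S" for a b
    unfolding d_def using \<alpha> \<beta> \<gamma> S_in_cuts by (cases a; cases b) simp_all
  have sym: "D s a b \<longleftrightarrow> D s b a" for s a b
    unfolding D_def d_def by (simp add: side_commute)
  have tri: "D t a c" if "D r a b" "D s b c" "t \<in> S" "gap r s t" for r s t a b c
    using triangle_cut_sum[OF \<alpha> \<beta>] that unfolding D_def d_def by blast
  have in_S: "s \<in> S" if "D s a b" for s a b
    using that d_cuts cuts_subset unfolding D_def by blast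
  \<comment> \<open>The triangle axiom for s + 0 = s, which turns \<open>D zero\<close> into a
    congruence.\<close>
  have right: "D s a b'" if "D zero b b'" "D s a b" for s a b b'
    using tri[OF that(2,1)] in_S[OF that(2)] gap_zero by blast
  \<comment> \<open>Equality is read as distance at most zero, so the first axiom of
    \<open>T_MS\<close> holds by definition. Different points may become equal in this sense, as
    \<open>PX\<close> and \<open>PY\<close> do when \<alpha> = \<open>S\<close>.\<close>
  interpret congruence_structure D "D zero"
  proof
    show "D zero a a" for a
      by (simp add: D_def d_def zero_in_S)
    show "D s a' b'" if "D zero a a'" "D zero b b'" "D s a b" for s a a' b b'
      using right that sym by blast
  qed (use sym right in blast)+
  show ?thesis
  proof (rule consistent_of_model[of _ e])
    fix \<psi>
    assume "\<psi> \<in> T_MS add le zero S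
      \<union> cut_type le S \<alpha> 0 1 \<union> cut_type le S \<beta> 1 2 \<union> cut_type le S ?\<gamma> 0 2"
    \<comment> \<open>The axiom for a maximum of \<open>S\<close> holds because every distance is a
      cut and so contains that maximum.\<close>
    moreover have "sat D (D zero) e \<psi>" if "\<psi> \<in> T_MS add le zero S"
      using that sym tri cuts_maximum[OF d_cuts]
      unfolding T_MS_def gap_def[symmetric]
      by (auto simp: numeral_2_eq_2 D_def)
    moreover have "sat D (D zero) e \<psi>" if "\<psi> \<in> cut_type le S \<alpha> 0 1"
      using that by (auto simp: cut_type_eq[OF \<alpha>] D_def d_def e_def)
    moreover have "sat D (D zero) e \<psi>" if "\<psi> \<in> cut_type le S \<beta> 1 2"
      using that by (auto simp: cut_type_eq[OF \<beta>] D_def d_def e_def numeral_2_eq_2)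
    moreover have "sat D (D zero) e \<psi>" if "\<psi> \<in> cut_type le S ?\<gamma> 0 2"
      using that by (auto simp: cut_type_eq[OF \<gamma>] D_def d_def e_def numeral_2_eq_2)
    ultimately show "sat D (D zero) e \<psi>" by blast
  qed
qed

text \<open>The sum is itself a consistent third side and is contained in all others, so the
  supremum is attained there; antisymmetry makes it unique.\<close>

lemma cut_add_eq:
  assumes "\<alpha> \<in> cuts le S" "\<beta> \<in> cuts le S"
  shows "cut_add add le zero S \<alpha> \<beta> = cut_sum \<alpha> \<beta>"
  unfolding cut_add_def
proof (rule the_equality, goal_cases)
  case 1
  then show ?case
    using cut_sum_in_cuts[OF assms] cut_sum_least[OF assms] consistent_cut_sum[OF assms]
    by (auto simp: is_supremum_def is_minimum_def cut_le_def)
next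
  case (2 \<sigma>)
  then show ?case
    using cut_sum_in_cuts[OF assms] cut_sum_least[OF assms] consistent_cut_sum[OF assms]
    unfolding is_supremum_def is_minimum_def cut_le_def by blast
qed

section \<open>Unions of cuts and difference-completeness\<close>

lemma Union_in_cuts:
  assumes "F \<subseteq> cuts le S" "F \<noteq> {}"
  shows "\<Union>F \<in> cuts le S"
  \<comment> \<open>Any member of \<open>F\<close> supplies the maximum of \<open>S\<close>, if
    there is one; the empty union would lack it.\<close>
  using assms unfolding cuts_def by blast

text \<open>Membership in a sum is witnessed by a single element of the second cut.\<close>

lemma cut_sum_Union: "cut_sum \<alpha> (\<Union>F) = (\<Union>X\<in>F. cut_sum \<alpha> X)"
  by (auto simp: cut_sum_def)

lemma cut_difference_complete:
  assumes \<alpha>: "\<alpha> \<in> cuts le S" and \<beta>: "\<beta> \<in> cuts le S"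
  shows "\<exists>m. is_minimum cut_le
    {x \<in> cuts le S. cut_le \<alpha> (cut_sum \<beta> x) \<and> cut_le \<beta> (cut_sum \<alpha> x)} m"
proof -
  let ?F = "{x \<in> cuts le S. cut_le \<alpha> (cut_sum \<beta> x) \<and> cut_le \<beta> (cut_sum \<alpha> x)}"
  \<comment> \<open>The larger of \<alpha> and \<beta> in the reversed order. A sum dominates each
    summand, so it belongs to the family, which is therefore nonempty.\<close>
  have i: "\<alpha> \<inter> \<beta> \<in> cuts le S"
    using \<alpha> \<beta> unfolding cuts_def by blast
  have "cut_sum \<beta> (\<alpha> \<inter> \<beta>) \<subseteq> \<alpha> \<inter> \<beta>" "cut_sum \<alpha> (\<alpha> \<inter> \<beta>) \<subseteq> \<alpha> \<inter> \<beta>"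
    using cut_sum_commute[OF \<alpha> i] cut_sum_commute[OF \<beta> i]
      cut_sum_subset[OF i \<alpha>] cut_sum_subset[OF i \<beta>] by auto
  with i have "\<alpha> \<inter> \<beta> \<in> ?F" by (auto simp: cut_le_def)
  then have "?F \<noteq> {}" by blast
  with Union_in_cuts[of ?F] have "\<Union>?F \<in> cuts le S" by blast
  \<comment> \<open>Each constraint bounds a sum by a fixed cut with respect to inclusion, so it
    passes to the union, which is the infimum for the reversed order.\<close>
  moreover have "cut_sum \<beta> (\<Union>?F) \<subseteq> \<alpha>" "cut_sum \<alpha> (\<Union>?F) \<subseteq> \<beta>"
    unfolding cut_sum_Union cut_le_def by blast+
  ultimately have "is_minimum cut_le ?F (\<Union>?F)"
    unfolding is_minimum_def cut_le_def by blast
  then show ?thesis ..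
qed

end

theorem theorem4p11:
  fixes R S :: "'a set" and add :: "'a \<Rightarrow> 'a \<Rightarrow> 'a" and le :: "'a \<Rightarrow> 'a \<Rightarrow> bool" and zero :: 'a
  assumes "distance_magma R add le zero"
    and "S \<subseteq> R"
    and "zero \<in> S"
  shows "difference_complete_distance_magma
           (cuts le S) (cut_add add le zero S) cut_le (cut_of le S zero)"
proof -
  interpret distance_magma_subset R add le zero S
    using assms by (simp add: distance_magma_subset_def distance_magma_subset_axioms_def)
  show ?thesis
  proof (unfold_locales, goal_cases)
    case 1
    then show ?case by (simp add: cut_of_zero S_in_cuts)
  next
    case 2
    then show ?case by (simp add: cut_add_eq cut_sum_in_cuts)
  next
    case 3
    then show ?case by (simp add: reflp_on_def cut_le_def)
  next
    case 4
    then show ?case by (auto simp: antisymp_on_def cut_le_def)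
  next
    case 5
    then show ?case by (auto simp: transp_on_def cut_le_def)
  next
    case 6
    then show ?case using cuts_linear by (auto simp: totalp_on_def cut_le_def)
  next
    case 7
    then show ?case by (simp add: cut_add_eq cut_sum_subset cut_le_def)
  next
    case 8
    then show ?case by (simp add: cut_add_eq cut_sum_mono cut_le_def)
  next
    case 9
    then show ?case by (simp add: cut_add_eq cut_sum_commute)
  next
    case 10
    then show ?case by (simp add: cut_add_eq cut_of_zero cut_sum_zero S_in_cuts)
  next
    case (11 r s)
    \<comment> \<open>Every x in the comprehension is a cut, so \<open>cut_add_eq\<close> applies
      inside it.\<close>
    then have "{x \<in> cuts le S. cut_le r (cut_add add le zero S s x)
          \<and> cut_le s (cut_add add le zero S r x)} =
        {x \<in> cuts le S. cut_le r (cut_sum s x) \<and> cut_le s (cut_sum r x)}"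
      by (auto simp: cut_add_eq)
    with cut_difference_complete[OF 11] show ?case by simp
  qed
qed

end
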